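(* Let $(\Omega,\Sigma,\mu)$ and $(\Omega,\Sigma,\nu)$ be two $\sigma$-finite measure spaces, let $p,q\in[1,+\infty]$, and let $g\in L_0(\Omega,\mu)$ be such that the multiplication operator $M_g:L_p(\Omega,\mu)\to L_q(\Omega,\nu)$, $f\mapsto g\cdot f$, is a well-defined bounded operator. Let $\Omega=\Omega_c\sqcup\Omega_s$ be the partition from the Lebesgue decomposition of $\mu$ with respect to $\nu$. Then the following are equivalent: i) $M_g\in\mathcal{B}(L_p(\Omega,\mu),L_q(\Omega,\nu))$ is coisometric; ii) $M_{\chi_{\Omega_c}/g}$ is a well-defined bounded operator in $\mathcal{B}(L_q(\Omega,\nu),L_p(\Omega,\mu))$, it is a right inverse of $M_g$ (that is, $M_gM_{\chi_{\Omega_c}/g}=1_{L_q(\Omega,\nu)}$), and it is isometric.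
   Context: All linear spaces are over $\mathbb{C}$; measures are nonnegative, $\sigma$-additive, with values in $[0,+\infty]$. $L_0(\Omega,\mu)$ is the space of measurable complex functions on $\Omega$. Lebesgue decomposition of $\mu$ with respect to $\nu$: a nonnegative measurable function $\rho_{\mu,\nu}$, a $\sigma$-finite measure $\mu_s$ and a set $\Omega_s\in\Sigma$ such that $\mu=\rho_{\mu,\nu}\cdot\nu+\mu_s$ and $\nu(\Omega_s)=\mu_s(\Omega_c)=0$, where $\Omega_c=\Omega\setminus\Omega_s$ and $(\rho\cdot\nu)(E)=\int_E\rho\,d\nu$. $M_h$ denotes multiplication by the measurable function $h$. $\chi_{\Omega_c}$ is the indicator function of $\Omega_c$; $\chi_{\Omega_c}/g$ is the function equal to $1/g$ on $\Omega_c$ and $0$ elsewhere (with value $0$ also at points where $g=0$). An operator $T:X\to Y$ between normed spaces is isometric if $\|T(x)\|=\|x\|$ for all $x\in X$; it is coisometric if it is contractive ($\|T\|\leq1$) and for every $c'>1$ and $y\in Y$ there is $x\in X$ with $T(x)=y$ and $\|x\|<c'\|y\|$ (for $y=0$ one takes $x=0$). *)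

theory Defs
  imports "HOL-Analysis.Analysis" "HOL-Probability.Essential_Supremum"
begin

text \<open>
  The spaces \<open>L\<^sub>p\<close> depend on a measure and an exponent, so they cannot be types. Complex normed
  spaces are therefore given as records with an explicit carrier.
\<close>

record 'v nspace =
  vcarrier :: "'v set"
  vzero :: 'v
  vadd :: "'v \<Rightarrow> 'v \<Rightarrow> 'v"
  vscale :: "complex \<Rightarrow> 'v \<Rightarrow> 'v"
  vnorm :: "'v \<Rightarrow> real"

definition bounded_ops :: "'v nspace \<Rightarrow> 'w nspace \<Rightarrow> ('v \<Rightarrow> 'w) set" where
  "bounded_ops X Y = {T.
     (\<forall>x\<in>vcarrier X. T x \<in> vcarrier Y) \<and>
     (\<forall>x\<in>vcarrier X. \<forall>y\<in>vcarrier X. T (vadd X x y) = vadd Y (T x) (T y)) \<and>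
     (\<forall>c. \<forall>x\<in>vcarrier X. T (vscale X c x) = vscale Y c (T x)) \<and>
     (\<exists>C. \<forall>x\<in>vcarrier X. vnorm Y (T x) \<le> C * vnorm X x)}"

definition op_norm :: "'v nspace \<Rightarrow> 'w nspace \<Rightarrow> ('v \<Rightarrow> 'w) \<Rightarrow> real" where
  "op_norm X Y T = Inf {C. 0 \<le> C \<and> (\<forall>x\<in>vcarrier X. vnorm Y (T x) \<le> C * vnorm X x)}"

definition isometric_op :: "'v nspace \<Rightarrow> 'w nspace \<Rightarrow> ('v \<Rightarrow> 'w) \<Rightarrow> bool" where
  "isometric_op X Y T \<longleftrightarrow> T \<in> bounded_ops X Y \<and> (\<forall>x\<in>vcarrier X. vnorm Y (T x) = vnorm X x)"

text \<open>
  The strict inequality in the lifting condition cannot hold for \<open>y = 0\<close>; there one takes \<open>x = 0\<close>.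
\<close>

definition coisometric_op :: "'v nspace \<Rightarrow> 'w nspace \<Rightarrow> ('v \<Rightarrow> 'w) \<Rightarrow> bool" where
  "coisometric_op X Y T \<longleftrightarrow>
     T \<in> bounded_ops X Y \<and> op_norm X Y T \<le> 1 \<and>
     (\<forall>c>1. \<forall>y\<in>vcarrier Y. \<exists>x\<in>vcarrier X.
        T x = y \<and> (if y = vzero Y then x = vzero X else vnorm X x < c * vnorm Y y))"

definition ae_rel :: "'a measure \<Rightarrow> (('a \<Rightarrow> complex) \<times> ('a \<Rightarrow> complex)) set" where
  "ae_rel M = {(f, f'). f \<in> borel_measurable M \<and> f' \<in> borel_measurable M \<and> (AE x in M. f x = f' x)}"

lemma equiv_ae_rel: "equiv (borel_measurable M) (ae_rel M)"
proof (rule equivI)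
  show "trans (ae_rel M)"
    by (auto simp: ae_rel_def trans_def elim: eventually_elim2)
qed (auto simp: ae_rel_def refl_on_def sym_def eq_commute)

text \<open>
  For \<open>p < \<infinity>\<close> this is the \<open>p\<close>-th power of the \<open>L\<^sub>p\<close> norm, with values in \<open>[0,\<infinity>]\<close>.
\<close>

definition Lp_size :: "ennreal \<Rightarrow> 'a measure \<Rightarrow> ('a \<Rightarrow> complex) \<Rightarrow> ennreal" where
  "Lp_size p M f =
     (if p = \<infinity> then esssup M (\<lambda>x. ennreal (cmod (f x)))
      else (\<integral>\<^sup>+x. ennreal (cmod (f x) powr enn2real p) \<partial>M))"

definition Lp_fun :: "ennreal \<Rightarrow> 'a measure \<Rightarrow> ('a \<Rightarrow> complex) set" where
  "Lp_fun p M = {f \<in> borel_measurable M. Lp_size p M f < \<infinity>}"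

definition Lp_seminorm :: "ennreal \<Rightarrow> 'a measure \<Rightarrow> ('a \<Rightarrow> complex) \<Rightarrow> real" where
  "Lp_seminorm p M f =
     (if p = \<infinity> then enn2real (Lp_size p M f)
      else enn2real (Lp_size p M f) powr (1 / enn2real p))"

text \<open>
  Elements are almost-everywhere classes of measurable functions. As in the theory of equivalence
  relations, an operation on classes is the union of the classes obtained from the
  representatives.
\<close>

definition Lp :: "ennreal \<Rightarrow> 'a measure \<Rightarrow> ('a \<Rightarrow> complex) set nspace" where
  "Lp p M = \<lparr>
     vcarrier = Lp_fun p M // ae_rel M,
     vzero = ae_rel M `` {\<lambda>x. 0},
     vadd = (\<lambda>F G. \<Union>f\<in>F. \<Union>g\<in>G. ae_rel M `` {\<lambda>x. f x + g x}),
     vscale = (\<lambda>c F. \<Union>f\<in>F. ae_rel M `` {\<lambda>x. c * f x}),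
     vnorm = (\<lambda>F. the_elem (Lp_seminorm p M ` F))\<rparr>"

lemma Lp_size_cong:
  assumes "(f, f') \<in> ae_rel M"
  shows "Lp_size p M f = Lp_size p M f'"
proof -
  have [measurable]: "f \<in> borel_measurable M" "f' \<in> borel_measurable M"
    and ae: "AE x in M. f x = f' x"
    using assms by (auto simp: ae_rel_def)
  have "esssup M (\<lambda>x. ennreal (cmod (f x))) = esssup M (\<lambda>x. ennreal (cmod (f' x)))"
    by (rule esssup_AE_cong) (use ae in auto)
  moreover have "(\<integral>\<^sup>+x. ennreal (cmod (f x) powr enn2real p) \<partial>M)
      = (\<integral>\<^sup>+x. ennreal (cmod (f' x) powr enn2real p) \<partial>M)"
    by (rule nn_integral_cong_AE) (use ae in auto)
  ultimately show ?thesis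
    by (simp add: Lp_size_def)
qed

lemma vnorm_Lp_class:
  assumes "f \<in> borel_measurable M"
  shows "vnorm (Lp p M) (ae_rel M `` {f}) = Lp_seminorm p M f"
proof -
  have "f \<in> ae_rel M `` {f}"
    using equiv_class_self[OF equiv_ae_rel] assms by blast
  moreover have "Lp_seminorm p M f' = Lp_seminorm p M f" if "f' \<in> ae_rel M `` {f}" for f'
    using Lp_size_cong[of f f' M p] that unfolding Lp_seminorm_def by auto
  ultimately have "Lp_seminorm p M ` (ae_rel M `` {f}) = {Lp_seminorm p M f}"
    by blast
  then show ?thesis
    by (simp add: Lp_def)
qed

definition mult_op :: "'a measure \<Rightarrow> ('a \<Rightarrow> complex) \<Rightarrow> ('a \<Rightarrow> complex) set \<Rightarrow> ('a \<Rightarrow> complex) set" where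
  "mult_op N h F = (\<Union>f\<in>F. ae_rel N `` {\<lambda>x. h x * f x})"

text \<open>
  The two measures may have different null sets, so independence of the representative is part of
  the requirement that multiplication by \<open>h\<close> is well defined from \<open>L\<^sub>p(M)\<close> to \<open>L\<^sub>q(N)\<close>.
\<close>

definition mult_well_defined ::
  "ennreal \<Rightarrow> 'a measure \<Rightarrow> ennreal \<Rightarrow> 'a measure \<Rightarrow> ('a \<Rightarrow> complex) \<Rightarrow> bool" where
  "mult_well_defined p M q N h \<longleftrightarrow>
     (\<forall>f\<in>Lp_fun p M. (\<lambda>x. h x * f x) \<in> Lp_fun q N) \<and>
     (\<forall>f\<in>Lp_fun p M. \<forall>f'\<in>Lp_fun p M.
        (AE x in M. f x = f' x) \<longrightarrow> (AE x in N. h x * f x = h x * f' x))"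

definition lebesgue_decomposition ::
  "'a measure \<Rightarrow> 'a measure \<Rightarrow> ('a \<Rightarrow> real) \<Rightarrow> 'a measure \<Rightarrow> 'a set \<Rightarrow> bool" where
  "lebesgue_decomposition M N \<rho> M\<^sub>s \<Omega>\<^sub>s \<longleftrightarrow>
     \<rho> \<in> borel_measurable N \<and> (\<forall>x\<in>space N. 0 \<le> \<rho> x) \<and>
     sigma_finite_measure M\<^sub>s \<and> sets M\<^sub>s = sets M \<and> \<Omega>\<^sub>s \<in> sets M \<and>
     (\<forall>E\<in>sets M. emeasure M E = emeasure (density N (\<lambda>x. ennreal (\<rho> x))) E + emeasure M\<^sub>s E) \<and>
     emeasure N \<Omega>\<^sub>s = 0 \<and> emeasure M\<^sub>s (space M - \<Omega>\<^sub>s) = 0"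

end

theory Submission
  imports Defs
begin

text \<open>
  Multiplication by \<open>g\<close> can only be inverted where \<open>\<nu>\<close> lives, that is on \<open>\<Omega>\<^sub>c\<close>, and there \<open>\<mu>\<close> is
  absolutely continuous with respect to \<open>\<nu>\<close> (\<open>AE_transfer_to_continuous_part\<close>). Write
  \<open>h = \<chi>/g\<close>, with \<open>\<chi>\<close> the indicator of \<open>\<Omega>\<^sub>c\<close>.

  Suppose that \<open>M\<^sub>g\<close> is coisometric. By \<open>\<sigma>\<close>-finiteness \<open>L\<^sub>q(\<nu>)\<close> contains a function without zeros
  (\<open>obtain_nowhere_zero_Lp_fun\<close>); a preimage of it under \<open>M\<^sub>g\<close> shows that \<open>g \<noteq> 0\<close> holds
  \<open>\<nu>\<close>-almost everywhere. Let \<open>f\<close> be any preimage of \<open>y\<close>. The equation \<open>g f = y\<close> holds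
  \<open>\<nu>\<close>-almost everywhere, so it holds \<open>\<mu>\<close>-almost everywhere on \<open>\<Omega>\<^sub>c\<close>, and wherever \<open>g \<noteq> 0\<close> it can be
  solved for \<open>f\<close>. Passing from \<open>f\<close> to \<open>h y\<close> therefore only replaces some values by zero
  (\<open>reciprocal_dominated_by_preimage\<close>) and cannot increase the norm. Hence \<open>h y\<close> is a preimage of \<open>y\<close>
  whose norm is the least possible, so \<open>\<parallel>h y\<parallel> \<le> c \<parallel>y\<parallel>\<close> for all \<open>c > 1\<close>, that is
  \<open>\<parallel>h y\<parallel> \<le> \<parallel>y\<parallel>\<close>. Contractivity of \<open>M\<^sub>g\<close> gives the opposite inequality.

  Conversely, suppose that \<open>M\<^sub>h\<close> is an isometric right inverse. Then \<open>M\<^sub>h y\<close> is a preimage of \<open>y\<close> of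
  the same norm, and \<open>M\<^sub>g\<close> is contractive because \<open>\<parallel>g f\<parallel> = \<parallel>h g f\<parallel> \<le> \<parallel>f\<parallel>\<close>, as \<open>h g\<close> is itself an
  indicator function.

  Both arguments work with functions; \<open>coisometric_mult_op_iff\<close> translates coisometry of the operator
  on classes into conditions on representatives.
\<close>

section \<open>Contractions between normed spaces\<close>

text \<open>
  The infimum that defines the operator norm is attained: admissible constants come arbitrarily close
  to it, and the defining inequality is closed under limits of the constant.
\<close>

lemma le_if_le_mult:
  fixes a b :: real
  assumes le: "\<And>c. 1 < c \<Longrightarrow> a \<le> c * b" and b: "0 \<le> b"
  shows "a \<le> b"
proof (cases "b = 0")
  case True
  then show ?thesis using le[of 2] by simp
next
  case False
  have "a / b \<le> c" if "1 < c" for c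
    using le[OF that] b False by (simp add: field_simps)
  then have "a / b \<le> 1" by (rule dense_ge)
  then show ?thesis using b False by (simp add: field_simps)
qed

lemma op_norm_le_1_iff:
  assumes T: "T \<in> bounded_ops X Y" and nonneg: "\<And>x. x \<in> vcarrier X \<Longrightarrow> 0 \<le> vnorm X x"
  shows "op_norm X Y T \<le> 1 \<longleftrightarrow> (\<forall>x\<in>vcarrier X. vnorm Y (T x) \<le> vnorm X x)"
proof -
  define S where "S = {C. 0 \<le> C \<and> (\<forall>x\<in>vcarrier X. vnorm Y (T x) \<le> C * vnorm X x)}"
  obtain C where C: "\<forall>x\<in>vcarrier X. vnorm Y (T x) \<le> C * vnorm X x"
    using T by (auto simp: bounded_ops_def)
  have "max C 0 \<in> S"
    unfolding S_def
  proof (intro CollectI conjI ballI)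
    fix x assume x: "x \<in> vcarrier X"
    have "C * vnorm X x \<le> max C 0 * vnorm X x"
      by (intro mult_right_mono nonneg x) simp
    then show "vnorm Y (T x) \<le> max C 0 * vnorm X x"
      using C x by fastforce
  qed simp
  then have ne: "S \<noteq> {}" by blast
  have bdd: "bdd_below S"
    by (rule bdd_belowI[of _ 0]) (simp add: S_def)
  show ?thesis
  proof
    assume "op_norm X Y T \<le> 1"
    then have le1: "Inf S \<le> 1" by (simp add: op_norm_def S_def)
    show "\<forall>x\<in>vcarrier X. vnorm Y (T x) \<le> vnorm X x"
    proof
      fix x assume x: "x \<in> vcarrier X"
      have bound: "vnorm Y (T x) \<le> c * vnorm X x" if "1 < c" for c
      proof -
        have "Inf S < c" using le1 that by simp
        then obtain D where "D \<in> S" "D < c"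
          using cInf_lessD[OF ne] by blast
        then have "vnorm Y (T x) \<le> D * vnorm X x" "D * vnorm X x \<le> c * vnorm X x"
          using x by (auto simp: S_def intro: mult_right_mono nonneg)
        then show ?thesis by linarith
      qed
      show "vnorm Y (T x) \<le> vnorm X x"
        by (rule le_if_le_mult[OF bound nonneg[OF x]])
    qed
  next
    assume "\<forall>x\<in>vcarrier X. vnorm Y (T x) \<le> vnorm X x"
    then have "1 \<in> S" by (simp add: S_def)
    then show "op_norm X Y T \<le> 1"
      using cInf_lower[OF _ bdd] by (simp add: op_norm_def S_def)
  qed
qed

section \<open>Classes and representatives\<close>

abbreviation ae_class :: "'a measure \<Rightarrow> ('a \<Rightarrow> complex) \<Rightarrow> ('a \<Rightarrow> complex) set" where
  "ae_class M f \<equiv> ae_rel M `` {f}"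

lemma ae_class_eq_iff:
  assumes "f \<in> borel_measurable M" "f' \<in> borel_measurable M"
  shows "ae_class M f = ae_class M f' \<longleftrightarrow> (AE x in M. f x = f' x)"
  using eq_equiv_class_iff[OF equiv_ae_rel assms] assms by (simp add: ae_rel_def)

lemma Lp_fun_measurable: "f \<in> Lp_fun p M \<Longrightarrow> f \<in> borel_measurable M"
  by (simp add: Lp_fun_def)

lemma vcarrier_Lp_iff: "F \<in> vcarrier (Lp p M) \<longleftrightarrow> (\<exists>f\<in>Lp_fun p M. F = ae_class M f)"
  unfolding Lp_def quotient_def nspace.simps by blast

lemma ball_vcarrier_Lp:
  "(\<forall>F\<in>vcarrier (Lp p M). P F) \<longleftrightarrow> (\<forall>f\<in>Lp_fun p M. P (ae_class M f))"
  by (metis vcarrier_Lp_iff)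

lemma vzero_Lp: "vzero (Lp p M) = ae_class M (\<lambda>x. 0)"
  by (simp add: Lp_def)

text \<open>
  Each operation on classes is a union of classes over representatives; it is a single class as soon
  as the resulting class does not depend on the representative.
\<close>

lemma UN_ae_class:
  assumes f: "f \<in> borel_measurable M"
    and meas: "\<And>f'. f' \<in> borel_measurable M \<Longrightarrow> (AE x in M. f x = f' x) \<Longrightarrow> t f' \<in> borel_measurable N"
    and ae: "\<And>f'. f' \<in> borel_measurable M \<Longrightarrow> (AE x in M. f x = f' x) \<Longrightarrow> (AE x in N. t f x = t f' x)"
  shows "(\<Union>f'\<in>ae_class M f. ae_class N (t f')) = ae_class N (t f)"
proof -
  have "ae_class N (t f') = ae_class N (t f)" if "f' \<in> ae_class M f" for f'
  proof -
    have f': "f' \<in> borel_measurable M" "AE x in M. f x = f' x"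
      using that by (auto simp: ae_rel_def)
    then have "ae_class N (t f) = ae_class N (t f')"
      by (subst ae_class_eq_iff) (use meas f ae in auto)
    then show ?thesis ..
  qed
  moreover have "f \<in> ae_class M f" using f by (simp add: ae_rel_def)
  ultimately show ?thesis by blast
qed

lemma vadd_Lp_class:
  assumes f: "f \<in> borel_measurable M" and k: "k \<in> borel_measurable M"
  shows "vadd (Lp p M) (ae_class M f) (ae_class M k) = ae_class M (\<lambda>x. f x + k x)"
proof -
  have "(\<Union>k'\<in>ae_class M k. ae_class M (\<lambda>x. f' x + k' x)) = ae_class M (\<lambda>x. f' x + k x)"
    if "f' \<in> borel_measurable M" for f'
    by (rule UN_ae_class[OF k]) (use that in auto)
  then have "vadd (Lp p M) (ae_class M f) (ae_class M k)
      = (\<Union>f'\<in>ae_class M f. ae_class M (\<lambda>x. f' x + k x))"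
    by (auto simp: Lp_def ae_rel_def)
  also have "\<dots> = ae_class M (\<lambda>x. f x + k x)"
    by (rule UN_ae_class[OF f]) (use k in auto)
  finally show ?thesis .
qed

lemma vscale_Lp_class:
  assumes f: "f \<in> borel_measurable M"
  shows "vscale (Lp p M) c (ae_class M f) = ae_class M (\<lambda>x. c * f x)"
  unfolding Lp_def nspace.simps by (rule UN_ae_class[OF f]) auto

lemma mult_op_class:
  assumes wd: "mult_well_defined p M q N h" and f: "f \<in> Lp_fun p M"
  shows "mult_op N h (ae_class M f) = ae_class N (\<lambda>x. h x * f x)"
  unfolding mult_op_def
proof (rule UN_ae_class)
  fix f' assume f': "f' \<in> borel_measurable M" "AE x in M. f x = f' x"
  then have "f' \<in> Lp_fun p M"
    using f Lp_size_cong[of f f' M p] by (auto simp: Lp_fun_def ae_rel_def)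
  then show "(\<lambda>x. h x * f' x) \<in> borel_measurable N" "AE x in N. h x * f x = h x * f' x"
    using wd f f'(2) by (auto simp: mult_well_defined_def Lp_fun_def)
qed (use f in \<open>simp add: Lp_fun_def\<close>)

section \<open>The norm of \<open>L\<^sub>p\<close>\<close>

lemma Lp_seminorm_nonneg: "0 \<le> Lp_seminorm p M f"
  by (simp add: Lp_seminorm_def)

lemma Lp_seminorm_cong:
  assumes "f \<in> borel_measurable M" "f' \<in> borel_measurable M" "AE x in M. f x = f' x"
  shows "Lp_seminorm p M f = Lp_seminorm p M f'"
proof -
  have "Lp_size p M f = Lp_size p M f'"
    by (rule Lp_size_cong) (use assms in \<open>simp add: ae_rel_def\<close>)
  then show ?thesis by (simp only: Lp_seminorm_def)
qed

lemma vnorm_Lp_nonneg: "F \<in> vcarrier (Lp p M) \<Longrightarrow> 0 \<le> vnorm (Lp p M) F"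
  by (auto simp: vcarrier_Lp_iff vnorm_Lp_class Lp_fun_measurable Lp_seminorm_nonneg)

lemma Lp_size_mono:
  assumes [measurable]: "f \<in> borel_measurable M" "f' \<in> borel_measurable M"
    and le: "AE x in M. cmod (f x) \<le> cmod (f' x)"
  shows "Lp_size p M f \<le> Lp_size p M f'"
proof -
  have "esssup M (\<lambda>x. ennreal (cmod (f x))) \<le> esssup M (\<lambda>x. ennreal (cmod (f' x)))"
    by (rule esssup_AE_mono) (use le in auto)
  moreover have "(\<integral>\<^sup>+x. ennreal (cmod (f x) powr enn2real p) \<partial>M)
      \<le> (\<integral>\<^sup>+x. ennreal (cmod (f' x) powr enn2real p) \<partial>M)"
    by (rule nn_integral_mono_AE) (use le in \<open>auto intro!: ennreal_leI powr_mono2\<close>)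
  ultimately show ?thesis by (simp add: Lp_size_def)
qed

lemma Lp_dominated:
  assumes "f \<in> borel_measurable M" "f' \<in> Lp_fun p M" "AE x in M. cmod (f x) \<le> cmod (f' x)"
  shows "f \<in> Lp_fun p M" and "Lp_seminorm p M f \<le> Lp_seminorm p M f'"
proof -
  have le: "Lp_size p M f \<le> Lp_size p M f'" and fin: "Lp_size p M f' < \<infinity>"
    using assms by (auto intro: Lp_size_mono simp: Lp_fun_def)
  then show "f \<in> Lp_fun p M"
    using assms by (auto simp: Lp_fun_def)
  have "enn2real (Lp_size p M f) \<le> enn2real (Lp_size p M f')"
    using le fin by (intro enn2real_mono) (auto simp: top.not_eq_extremum)
  then show "Lp_seminorm p M f \<le> Lp_seminorm p M f'"
    by (auto simp: Lp_seminorm_def intro!: powr_mono2)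
qed

lemma Lp_zero:
  shows "(\<lambda>x. 0) \<in> Lp_fun p M" and "Lp_seminorm p M (\<lambda>x. 0) = 0"
proof -
  have "esssup M (\<lambda>x. 0::ennreal) \<le> 0"
    by (rule esssup_I) auto
  then have "Lp_size p M (\<lambda>x. 0) = 0"
    by (simp add: Lp_size_def)
  then show "(\<lambda>x. 0) \<in> Lp_fun p M" and "Lp_seminorm p M (\<lambda>x. 0) = 0"
    by (auto simp: Lp_fun_def Lp_seminorm_def)
qed

lemma AE_zero_if_Lp_seminorm_zero:
  assumes f: "f \<in> Lp_fun p M" and zero: "Lp_seminorm p M f = 0"
  shows "AE x in M. f x = 0"
proof -
  have [measurable]: "f \<in> borel_measurable M" and fin: "Lp_size p M f < \<infinity>"
    using f by (auto simp: Lp_fun_def)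
  have size: "Lp_size p M f = 0"
    using zero fin by (auto simp: Lp_seminorm_def enn2real_eq_0_iff split: if_splits)
  show ?thesis
  proof (cases "p = \<infinity>")
    case True
    have "AE x in M. ennreal (cmod (f x)) \<le> esssup M (\<lambda>x. ennreal (cmod (f x)))"
      by (rule esssup_AE)
    then show ?thesis
      using size True by (simp add: Lp_size_def)
  next
    case False
    then have "AE x in M. ennreal (cmod (f x) powr enn2real p) = 0"
      using size by (subst nn_integral_0_iff_AE[symmetric]) (auto simp: Lp_size_def)
    then show ?thesis by (simp add: ennreal_eq_0_iff)
  qed
qed

text \<open>
  An integrable function with values in \<open>(0,1]\<close>, which \<open>\<sigma>\<close>-finiteness provides, lies in every
  \<open>L\<^sub>q\<close> at once, since \<open>t\<^sup>q \<le> t\<close> for \<open>t \<le> 1\<close>.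
\<close>

lemma (in sigma_finite_measure) obtain_nowhere_zero_Lp_fun:
  assumes "1 \<le> q"
  obtains y where "y \<in> Lp_fun q M" "\<And>x. x \<in> space M \<Longrightarrow> y x \<noteq> 0"
proof -
  obtain f :: "'a \<Rightarrow> real" where f: "f \<in> borel_measurable M" "\<And>x. f x > 0" "\<And>x. f x \<le> 1"
      "integrable M f"
    using obtain_positive_integrable_function by blast
  note [measurable] = f(1)
  define y where "y = (\<lambda>x. complex_of_real (f x))"
  have cmod_y: "cmod (y x) = f x" for x using f(2)[of x] by (simp add: y_def)
  have "Lp_size q M y < \<infinity>"
  proof (cases "q = \<infinity>")
    case True
    have "esssup M (\<lambda>x. ennreal (cmod (y x))) \<le> 1"
      unfolding cmod_y by (rule esssup_I) (auto simp: f(3))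
    then show ?thesis using True by (auto simp: Lp_size_def intro: le_less_trans)
  next
    case False
    then have q: "1 \<le> enn2real q"
      using assms by (cases q) (auto simp: ennreal_le_iff2 simp flip: ennreal_1)
    have "f x powr enn2real q \<le> f x" for x
      using powr_mono'[OF q, of "f x"] f(2)[of x] f(3)[of x] by simp
    then have "(\<integral>\<^sup>+x. ennreal (cmod (y x) powr enn2real q) \<partial>M) \<le> (\<integral>\<^sup>+x. ennreal (norm (f x)) \<partial>M)"
      by (intro nn_integral_mono ennreal_leI) (smt (verit) cmod_y real_norm_def f(2))
    also have "\<dots> < \<infinity>"
      using f(4) by (simp add: integrable_iff_bounded)
    finally show ?thesis using False by (simp add: Lp_size_def)
  qed
  then have "y \<in> Lp_fun q M" by (simp add: Lp_fun_def y_def)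
  moreover have "y x \<noteq> 0" for x using f(2)[of x] by (simp add: y_def)
  ultimately show ?thesis using that by blast
qed

section \<open>Multiplication operators\<close>

text \<open>
  A sum of two representatives is multiplied by \<open>h\<close> before it is known to be \<open>p\<close>-integrable;
  hence \<open>cong\<close> is required for all measurable functions.
\<close>

lemma mult_op_bounded_if_contractive:
  assumes h: "\<And>f. f \<in> borel_measurable M \<Longrightarrow> (\<lambda>x. h x * f x) \<in> borel_measurable N"
    and cong: "\<And>f f'. f \<in> borel_measurable M \<Longrightarrow> f' \<in> borel_measurable M \<Longrightarrow>
      (AE x in M. f x = f' x) \<Longrightarrow> (AE x in N. h x * f x = h x * f' x)"
    and maps: "\<And>f. f \<in> Lp_fun p M \<Longrightarrow> (\<lambda>x. h x * f x) \<in> Lp_fun q N"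
    and contr: "\<And>f. f \<in> Lp_fun p M \<Longrightarrow> Lp_seminorm q N (\<lambda>x. h x * f x) \<le> Lp_seminorm p M f"
  shows "mult_op N h \<in> bounded_ops (Lp p M) (Lp q N)"
proof -
  have cls: "mult_op N h (ae_class M f) = ae_class N (\<lambda>x. h x * f x)"
    if "f \<in> borel_measurable M" for f
    unfolding mult_op_def by (rule UN_ae_class) (use that h cong in blast)+
  note meas = Lp_fun_measurable
  show ?thesis
    unfolding bounded_ops_def
  proof (intro CollectI conjI ballI allI)
    fix F assume "F \<in> vcarrier (Lp p M)"
    then show "mult_op N h F \<in> vcarrier (Lp q N)"
      using maps cls meas unfolding vcarrier_Lp_iff by blast
  next
    fix F K assume "F \<in> vcarrier (Lp p M)" "K \<in> vcarrier (Lp p M)"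
    then obtain f k where fk: "f \<in> Lp_fun p M" "k \<in> Lp_fun p M" "F = ae_class M f" "K = ae_class M k"
      by (auto simp: vcarrier_Lp_iff)
    have [measurable]: "f \<in> borel_measurable M" "k \<in> borel_measurable M"
      using fk(1,2) meas by auto
    show "mult_op N h (vadd (Lp p M) F K) = vadd (Lp q N) (mult_op N h F) (mult_op N h K)"
      by (simp add: fk(3,4) vadd_Lp_class cls h distrib_left)
  next
    fix c F assume "F \<in> vcarrier (Lp p M)"
    then obtain f where f: "f \<in> Lp_fun p M" "F = ae_class M f"
      by (auto simp: vcarrier_Lp_iff)
    have [measurable]: "f \<in> borel_measurable M"
      using f(1) meas by auto
    show "mult_op N h (vscale (Lp p M) c F) = vscale (Lp q N) c (mult_op N h F)"
      by (simp add: f(2) vscale_Lp_class cls h mult.left_commute)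
  next
    have "vnorm (Lp q N) (mult_op N h F) \<le> 1 * vnorm (Lp p M) F" if "F \<in> vcarrier (Lp p M)" for F
      using that contr by (auto simp: vcarrier_Lp_iff cls meas vnorm_Lp_class h)
    then show "\<exists>C. \<forall>F\<in>vcarrier (Lp p M). vnorm (Lp q N) (mult_op N h F) \<le> C * vnorm (Lp p M) F"
      by blast
  qed
qed

text \<open>
  On representatives the lifting condition loses its exceptional case \<open>y = 0\<close>: with \<open>\<le>\<close> in place of
  \<open><\<close>, the zero function is a valid preimage there.
\<close>

lemma coisometric_mult_op_iff:
  assumes wd: "mult_well_defined p M q N g"
    and bdd: "mult_op N g \<in> bounded_ops (Lp p M) (Lp q N)"
  shows "coisometric_op (Lp p M) (Lp q N) (mult_op N g) \<longleftrightarrow>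
    (\<forall>f\<in>Lp_fun p M. Lp_seminorm q N (\<lambda>x. g x * f x) \<le> Lp_seminorm p M f) \<and>
    (\<forall>c>1. \<forall>y\<in>Lp_fun q N. \<exists>f\<in>Lp_fun p M.
       (AE x in N. g x * f x = y x) \<and> Lp_seminorm p M f \<le> c * Lp_seminorm q N y)"
    (is "?coiso \<longleftrightarrow> ?contr \<and> ?lift")
proof -
  note meas = Lp_fun_measurable[of _ p M] Lp_fun_measurable[of _ q N]
  have maps: "(\<lambda>x. g x * f x) \<in> Lp_fun q N" if "f \<in> Lp_fun p M" for f
    using wd that by (simp add: mult_well_defined_def)
  note cls = mult_op_class[OF wd]
  have contr_iff: "op_norm (Lp p M) (Lp q N) (mult_op N g) \<le> 1 \<longleftrightarrow> ?contr"
    by (simp add: op_norm_le_1_iff[OF bdd vnorm_Lp_nonneg] ball_vcarrier_Lp cls vnorm_Lp_class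
        meas maps)
  define L where "L c y \<longleftrightarrow> (\<exists>f\<in>Lp_fun p M.
       (AE x in N. g x * f x = y x) \<and> Lp_seminorm p M f \<le> c * Lp_seminorm q N y)" for c y
  define K where "K c Y \<longleftrightarrow> (\<exists>F\<in>vcarrier (Lp p M). mult_op N g F = Y \<and>
      (if Y = vzero (Lp q N) then F = vzero (Lp p M)
       else vnorm (Lp p M) F < c * vnorm (Lp q N) Y))" for c Y
  have L_if_K: "L c y" if c: "1 < c" and y: "y \<in> Lp_fun q N" and K: "K c (ae_class N y)" for c y
  proof -
    obtain f where f: "f \<in> Lp_fun p M" and eq: "ae_class N (\<lambda>x. g x * f x) = ae_class N y"
      and norm: "if ae_class N y = ae_class N (\<lambda>x. 0) then ae_class M f = ae_class M (\<lambda>x. 0)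
        else Lp_seminorm p M f < c * Lp_seminorm q N y"
    proof -
      obtain F where F: "F \<in> vcarrier (Lp p M)" "mult_op N g F = ae_class N y"
          "if ae_class N y = vzero (Lp q N) then F = vzero (Lp p M)
           else vnorm (Lp p M) F < c * vnorm (Lp q N) (ae_class N y)"
        using K unfolding K_def by blast
      then obtain f where f: "f \<in> Lp_fun p M" "F = ae_class M f"
        by (auto simp: vcarrier_Lp_iff)
      show thesis
        by (rule that[of f])
          (use F(2,3)[unfolded f(2)] y f(1) in \<open>simp_all add: cls vzero_Lp vnorm_Lp_class meas
            split: if_splits\<close>)
    qed
    have "Lp_seminorm p M f \<le> c * Lp_seminorm q N y"
    proof (cases "ae_class N y = ae_class N (\<lambda>x. 0)")
      case True
      then have "AE x in M. f x = 0"
        using norm f by (simp add: ae_class_eq_iff meas)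
      then have "Lp_seminorm p M f = 0"
        using Lp_seminorm_cong[of f M "\<lambda>x. 0" p] f by (simp add: meas Lp_zero(2))
      then show ?thesis using c by (simp add: Lp_seminorm_nonneg)
    next
      case False
      then show ?thesis using norm by simp
    qed
    moreover have "AE x in N. g x * f x = y x"
      using eq f y by (simp add: ae_class_eq_iff meas maps)
    ultimately show ?thesis using f unfolding L_def by blast
  qed
  have K_if_L: "K c (ae_class N y)" if c: "1 < c" and y: "y \<in> Lp_fun q N"
    and L: "\<And>c. 1 < c \<Longrightarrow> L c y" for c y
  proof (cases "ae_class N y = ae_class N (\<lambda>x. 0)")
    case True
    then show ?thesis
      using Lp_zero(1)[of p M] cls[OF Lp_zero(1)]
      by (auto simp: K_def vzero_Lp vcarrier_Lp_iff intro!: bexI[of _ "ae_class M (\<lambda>x. 0)"])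
  next
    case False
    then have pos: "0 < Lp_seminorm q N y"
      using AE_zero_if_Lp_seminorm_zero[OF y] Lp_seminorm_nonneg[of q N y] y
      by (auto simp: ae_class_eq_iff meas less_le)
    \<comment> \<open>The slack between \<open>c\<close> and a smaller constant turns \<open>\<le>\<close> into \<open><\<close>.\<close>
    obtain d where d: "1 < d" "d < c" using c dense by blast
    obtain f where f: "f \<in> Lp_fun p M" "AE x in N. g x * f x = y x"
        "Lp_seminorm p M f \<le> d * Lp_seminorm q N y"
      using L[OF d(1)] by (auto simp: L_def)
    have "d * Lp_seminorm q N y < c * Lp_seminorm q N y"
      using d pos by simp
    moreover have "mult_op N g (ae_class M f) = ae_class N y"
      using f y by (simp add: cls ae_class_eq_iff meas maps)
    moreover have "ae_class M f \<in> vcarrier (Lp p M)"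
      unfolding vcarrier_Lp_iff using f(1) by blast
    moreover have "vnorm (Lp p M) (ae_class M f) = Lp_seminorm p M f"
        "vnorm (Lp q N) (ae_class N y) = Lp_seminorm q N y"
      using f(1) y by (simp_all add: vnorm_Lp_class meas)
    ultimately show ?thesis
      using f(3) False unfolding K_def vzero_Lp by (intro bexI[of _ "ae_class M f"]) simp_all
  qed
  have "(\<forall>c>1. \<forall>Y\<in>vcarrier (Lp q N). K c Y) \<longleftrightarrow> (\<forall>c>1. \<forall>y\<in>Lp_fun q N. L c y)"
    unfolding ball_vcarrier_Lp
  proof (intro iffI allI impI ballI)
    fix c :: real and y
    assume "1 < c" "y \<in> Lp_fun q N" "\<forall>c>1. \<forall>y\<in>Lp_fun q N. K c (ae_class N y)"
    then show "L c y" by (simp add: L_if_K)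
  next
    fix c :: real and y
    assume "1 < c" "y \<in> Lp_fun q N" "\<forall>c>1. \<forall>y\<in>Lp_fun q N. L c y"
    then show "K c (ae_class N y)" by (simp add: K_if_L)
  qed
  then show ?thesis
    unfolding coisometric_op_def contr_iff K_def L_def using bdd by blast
qed

section \<open>The absolutely continuous part\<close>

text \<open>
  Off \<open>\<Omega>\<^sub>s\<close> the singular measure vanishes, so there \<open>M\<close> is the measure with density \<open>\<rho>\<close> with respect
  to \<open>N\<close>, and that measure has all null sets of \<open>N\<close>.
\<close>

lemma AE_transfer_to_continuous_part:
  assumes sets: "sets N = sets M" and dec: "lebesgue_decomposition M N \<rho> M\<^sub>s \<Omega>\<^sub>s"
    and ae: "AE x in N. P x"
  shows "AE x in M. x \<notin> \<Omega>\<^sub>s \<longrightarrow> P x"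
proof -
  have \<rho>: "\<rho> \<in> borel_measurable N" and \<Omega>\<^sub>s: "\<Omega>\<^sub>s \<in> sets M" and sets_s: "sets M\<^sub>s = sets M"
    and sum: "\<And>E. E \<in> sets M \<Longrightarrow>
      emeasure M E = emeasure (density N (\<lambda>x. ennreal (\<rho> x))) E + emeasure M\<^sub>s E"
    and s0: "emeasure M\<^sub>s (space M - \<Omega>\<^sub>s) = 0"
    using dec by (auto simp: lebesgue_decomposition_def)
  obtain Z where Z: "{x\<in>space N. \<not> P x} \<subseteq> Z" "emeasure N Z = 0" "Z \<in> sets N"
    using ae by (rule AE_E)
  define E where "E = Z - \<Omega>\<^sub>s"
  have E: "E \<in> sets M" using Z(3) \<Omega>\<^sub>s sets by (auto simp: E_def)
  have "E \<in> null_sets N"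
  proof (rule null_sets_subset)
    show "Z \<in> null_sets N" using Z(2,3) by (rule null_setsI)
  qed (use E sets in \<open>auto simp: E_def\<close>)
  then have "AE x in N. x \<notin> E" by (rule AE_not_in)
  then have "AE x in N. x \<in> E \<longrightarrow> ennreal (\<rho> x) = 0" by eventually_elim simp
  then have "E \<in> null_sets (density N (\<lambda>x. ennreal (\<rho> x)))"
    using \<rho> E sets by (subst null_sets_density_iff) auto
  moreover have "emeasure M\<^sub>s E \<le> emeasure M\<^sub>s (space M - \<Omega>\<^sub>s)"
    using \<Omega>\<^sub>s sets_s sets.sets_into_space[OF E] by (intro emeasure_mono) (auto simp: E_def)
  ultimately have "emeasure M E = 0"
    using sum[OF E] s0 by auto
  then have "E \<in> null_sets M" using E by auto
  then show ?thesis
    by (rule AE_I') (use Z(1) sets_eq_imp_space_eq[OF sets] in \<open>auto simp: E_def\<close>)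
qed

text \<open>
  Almost everywhere off \<open>\<Omega>\<^sub>s\<close> the preimage \<open>f\<close> of \<open>y\<close> has to be \<open>y/g\<close> where \<open>g \<noteq> 0\<close>; everywhere
  else the left-hand side is zero, at zeros of \<open>g\<close> because division by zero yields zero.
\<close>

lemma reciprocal_dominated_by_preimage:
  fixes g f y :: "'a \<Rightarrow> complex"
  assumes sets: "sets N = sets M" and dec: "lebesgue_decomposition M N \<rho> M\<^sub>s \<Omega>\<^sub>s"
    and ae: "AE x in N. g x * f x = y x"
  shows "AE x in M. cmod (indicator (space M - \<Omega>\<^sub>s) x / g x * y x) \<le> cmod (f x)"
  using AE_transfer_to_continuous_part[OF sets dec ae]
proof eventually_elim
  case (elim x)
  show ?case
  proof (cases "x \<in> \<Omega>\<^sub>s \<or> g x = 0")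
    case True
    then show ?thesis by (auto simp: indicator_def)
  next
    case False
    then have "y x = g x * f x" using elim by simp
    then show ?thesis using False by (simp add: indicator_def)
  qed
qed

section \<open>Coisometric multiplication operators\<close>

theorem theorem2p4p4:
  fixes \<mu> \<nu> \<mu>\<^sub>s :: "'a measure" and p q :: ennreal and g :: "'a \<Rightarrow> complex"
    and \<rho> :: "'a \<Rightarrow> real" and \<Omega>\<^sub>c \<Omega>\<^sub>s :: "'a set"
  assumes "sigma_finite_measure \<mu>" and "sigma_finite_measure \<nu>" and "sets \<nu> = sets \<mu>"
    and "1 \<le> p" and "1 \<le> q"
    and "g \<in> borel_measurable \<mu>"
    and "mult_well_defined p \<mu> q \<nu> g"
    and "mult_op \<nu> g \<in> bounded_ops (Lp p \<mu>) (Lp q \<nu>)"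
    and "lebesgue_decomposition \<mu> \<nu> \<rho> \<mu>\<^sub>s \<Omega>\<^sub>s"
    and "\<Omega>\<^sub>c = space \<mu> - \<Omega>\<^sub>s"
  shows "coisometric_op (Lp p \<mu>) (Lp q \<nu>) (mult_op \<nu> g) \<longleftrightarrow>
    (mult_well_defined q \<nu> p \<mu> (\<lambda>x. indicator \<Omega>\<^sub>c x / g x) \<and>
     mult_op \<mu> (\<lambda>x. indicator \<Omega>\<^sub>c x / g x) \<in> bounded_ops (Lp q \<nu>) (Lp p \<mu>) \<and>
     (\<forall>y\<in>vcarrier (Lp q \<nu>). mult_op \<nu> g (mult_op \<mu> (\<lambda>x. indicator \<Omega>\<^sub>c x / g x) y) = y) \<and>
     isometric_op (Lp q \<nu>) (Lp p \<mu>) (mult_op \<mu> (\<lambda>x. indicator \<Omega>\<^sub>c x / g x)))"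
    (is "?coiso \<longleftrightarrow> _")
proof -
  note sf_\<nu> = assms(2) and sets = assms(3) and q = assms(5)
    and wd = assms(7) and bdd = assms(8) and dec = assms(9)
  define h where "h x = indicator \<Omega>\<^sub>c x / g x" for x
  note meas_\<mu> = Lp_fun_measurable[of _ p \<mu>] and meas_\<nu> = Lp_fun_measurable[of _ q \<nu>]
  have m_eq: "borel_measurable \<nu> = (borel_measurable \<mu> :: ('a \<Rightarrow> complex) set)"
    by (rule measurable_cong_sets) (simp_all add: sets)
  have \<Omega>\<^sub>s [measurable]: "\<Omega>\<^sub>s \<in> sets \<mu>" and \<nu>\<Omega>\<^sub>s: "emeasure \<nu> \<Omega>\<^sub>s = 0"
    using dec by (auto simp: lebesgue_decomposition_def)
  have [measurable]: "g \<in> borel_measurable \<mu>" by fact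
  have h_meas [measurable]: "h \<in> borel_measurable \<mu>"
    unfolding h_def assms(10) by measurable
  have ae_c: "AE x in \<nu>. x \<in> \<Omega>\<^sub>c"
  proof -
    have "\<Omega>\<^sub>s \<in> null_sets \<nu>" using \<Omega>\<^sub>s \<nu>\<Omega>\<^sub>s sets by auto
    from AE_not_in[OF this] AE_space show ?thesis
      by eventually_elim (simp add: assms(10) sets_eq_imp_space_eq[OF sets])
  qed
  have maps_g: "(\<lambda>x. g x * f x) \<in> Lp_fun q \<nu>" if "f \<in> Lp_fun p \<mu>" for f
    using wd that by (simp add: mult_well_defined_def)
  note dominated = reciprocal_dominated_by_preimage
      [OF sets dec, where g = g, folded assms(10), folded h_def]
  note coiso_iff = coisometric_mult_op_iff[OF wd bdd]
  have "?coiso \<longleftrightarrow> mult_well_defined q \<nu> p \<mu> h \<and>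
     mult_op \<mu> h \<in> bounded_ops (Lp q \<nu>) (Lp p \<mu>) \<and>
     (\<forall>Y\<in>vcarrier (Lp q \<nu>). mult_op \<nu> g (mult_op \<mu> h Y) = Y) \<and>
     isometric_op (Lp q \<nu>) (Lp p \<mu>) (mult_op \<mu> h)"
  proof
    assume ?coiso
    then have contr: "\<And>f. f \<in> Lp_fun p \<mu> \<Longrightarrow> Lp_seminorm q \<nu> (\<lambda>x. g x * f x) \<le> Lp_seminorm p \<mu> f"
      and lift: "\<And>c y. 1 < c \<Longrightarrow> y \<in> Lp_fun q \<nu> \<Longrightarrow> \<exists>f\<in>Lp_fun p \<mu>.
        (AE x in \<nu>. g x * f x = y x) \<and> Lp_seminorm p \<mu> f \<le> c * Lp_seminorm q \<nu> y"
      unfolding coiso_iff by blast+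
    \<comment> \<open>A function without zeros has a preimage, so \<open>g\<close> can vanish only on a \<open>\<nu>\<close>-null set.\<close>
    have g_nz: "AE x in \<nu>. g x \<noteq> 0"
    proof -
      obtain y where y: "y \<in> Lp_fun q \<nu>" "\<And>x. x \<in> space \<nu> \<Longrightarrow> y x \<noteq> 0"
        using sigma_finite_measure.obtain_nowhere_zero_Lp_fun[OF sf_\<nu> q] by blast
      obtain f where "AE x in \<nu>. g x * f x = y x"
        using lift[of 2 y] y(1) by auto
      with AE_space show ?thesis
        by eventually_elim (use y(2) in force)
    qed
    have cong: "AE x in \<mu>. h x * f x = h x * f' x" if "AE x in \<nu>. f x = f' x" for f f'
      using AE_transfer_to_continuous_part[OF sets dec that]
      by eventually_elim (auto simp: h_def assms(10) indicator_def)
    have inverse: "AE x in \<nu>. g x * (h x * y x) = y x" for y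
      using g_nz ae_c by eventually_elim (simp add: h_def)
    have h_y: "(\<lambda>x. h x * y x) \<in> borel_measurable \<mu>" if "y \<in> borel_measurable \<nu>" for y
      using that[unfolded m_eq] by measurable
    have maps: "(\<lambda>x. h x * y x) \<in> Lp_fun p \<mu>"
      and bound: "1 < c \<Longrightarrow> Lp_seminorm p \<mu> (\<lambda>x. h x * y x) \<le> c * Lp_seminorm q \<nu> y"
      if y: "y \<in> Lp_fun q \<nu>" for y c
    proof -
      have dom: "(\<lambda>x. h x * y x) \<in> Lp_fun p \<mu>"
          "Lp_seminorm p \<mu> (\<lambda>x. h x * y x) \<le> Lp_seminorm p \<mu> f"
        if "f \<in> Lp_fun p \<mu>" "AE x in \<nu>. g x * f x = y x" for f
        using Lp_dominated[OF h_y[OF meas_\<nu>[OF y]] that(1) dominated[OF that(2)]] .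
      show "(\<lambda>x. h x * y x) \<in> Lp_fun p \<mu>"
        using lift[of 2, OF _ y] dom(1) by auto
      show "Lp_seminorm p \<mu> (\<lambda>x. h x * y x) \<le> c * Lp_seminorm q \<nu> y" if "1 < c"
        using lift[OF that y] dom(2) by (meson order_trans)
    qed
    have le: "Lp_seminorm p \<mu> (\<lambda>x. h x * y x) \<le> Lp_seminorm q \<nu> y" if "y \<in> Lp_fun q \<nu>" for y
      using bound[OF that] Lp_seminorm_nonneg by (rule le_if_le_mult)
    \<comment> \<open>Contractivity of \<open>M\<^sub>g\<close>, applied to \<open>h y\<close>, as \<open>g h y = y\<close>.\<close>
    have ge: "Lp_seminorm q \<nu> y \<le> Lp_seminorm p \<mu> (\<lambda>x. h x * y x)" if y: "y \<in> Lp_fun q \<nu>" for y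
      using contr[OF maps[OF y]] Lp_seminorm_cong[OF _ meas_\<nu>[OF y] inverse, of q]
        meas_\<nu>[OF maps_g[OF maps[OF y]]] by simp
    have wd_h: "mult_well_defined q \<nu> p \<mu> h"
      using maps cong by (auto simp: mult_well_defined_def)
    have bdd_h: "mult_op \<mu> h \<in> bounded_ops (Lp q \<nu>) (Lp p \<mu>)"
      using h_y cong maps le by (rule mult_op_bounded_if_contractive)
    moreover have "mult_op \<nu> g (mult_op \<mu> h Y) = Y" if Y: "Y \<in> vcarrier (Lp q \<nu>)" for Y
    proof -
      obtain y where y: "y \<in> Lp_fun q \<nu>" "Y = ae_class \<nu> y"
        using Y by (auto simp: vcarrier_Lp_iff)
      have "mult_op \<nu> g (mult_op \<mu> h Y) = ae_class \<nu> (\<lambda>x. g x * (h x * y x))"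
        using y by (simp add: mult_op_class[OF wd_h] mult_op_class[OF wd] maps)
      also have "\<dots> = Y"
        unfolding y(2) by (subst ae_class_eq_iff) (use y(1) inverse in \<open>simp_all add: meas_\<nu> maps maps_g\<close>)
      finally show ?thesis .
    qed
    moreover have "vnorm (Lp p \<mu>) (mult_op \<mu> h Y) = vnorm (Lp q \<nu>) Y"
      if Y: "Y \<in> vcarrier (Lp q \<nu>)" for Y
    proof -
      obtain y where y: "y \<in> Lp_fun q \<nu>" "Y = ae_class \<nu> y"
        using Y by (auto simp: vcarrier_Lp_iff)
      then show ?thesis
        using antisym[OF le[OF y(1)] ge[OF y(1)]]
        by (simp add: mult_op_class[OF wd_h] vnorm_Lp_class meas_\<mu> meas_\<nu> maps)
    qed
    ultimately show "mult_well_defined q \<nu> p \<mu> h \<and>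
        mult_op \<mu> h \<in> bounded_ops (Lp q \<nu>) (Lp p \<mu>) \<and>
        (\<forall>Y\<in>vcarrier (Lp q \<nu>). mult_op \<nu> g (mult_op \<mu> h Y) = Y) \<and>
        isometric_op (Lp q \<nu>) (Lp p \<mu>) (mult_op \<mu> h)"
      using wd_h by (simp add: isometric_op_def)
  next
    assume "mult_well_defined q \<nu> p \<mu> h \<and>
        mult_op \<mu> h \<in> bounded_ops (Lp q \<nu>) (Lp p \<mu>) \<and>
        (\<forall>Y\<in>vcarrier (Lp q \<nu>). mult_op \<nu> g (mult_op \<mu> h Y) = Y) \<and>
        isometric_op (Lp q \<nu>) (Lp p \<mu>) (mult_op \<mu> h)"
    then have wd_h: "mult_well_defined q \<nu> p \<mu> h"
      and rinv: "\<And>Y. Y \<in> vcarrier (Lp q \<nu>) \<Longrightarrow> mult_op \<nu> g (mult_op \<mu> h Y) = Y"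
      and iso: "\<And>Y. Y \<in> vcarrier (Lp q \<nu>) \<Longrightarrow> vnorm (Lp p \<mu>) (mult_op \<mu> h Y) = vnorm (Lp q \<nu>) Y"
      by (auto simp: isometric_op_def)
    have maps: "(\<lambda>x. h x * y x) \<in> Lp_fun p \<mu>" if "y \<in> Lp_fun q \<nu>" for y
      using wd_h that by (simp add: mult_well_defined_def)
    have mem: "ae_class \<nu> y \<in> vcarrier (Lp q \<nu>)" if "y \<in> Lp_fun q \<nu>" for y
      unfolding vcarrier_Lp_iff using that by blast
    have norm_eq: "Lp_seminorm p \<mu> (\<lambda>x. h x * y x) = Lp_seminorm q \<nu> y"
      if y: "y \<in> Lp_fun q \<nu>" for y
      using iso[OF mem[OF y]] y
      by (simp add: mult_op_class[OF wd_h] vnorm_Lp_class meas_\<mu> meas_\<nu> maps)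
    have inverse: "AE x in \<nu>. g x * (h x * y x) = y x" if y: "y \<in> Lp_fun q \<nu>" for y
    proof -
      from rinv[OF mem[OF y]] have "ae_class \<nu> (\<lambda>x. g x * (h x * y x)) = ae_class \<nu> y"
        using y by (simp add: mult_op_class[OF wd_h] mult_op_class[OF wd] maps)
      then show ?thesis
        by (subst (asm) ae_class_eq_iff) (use y in \<open>simp_all add: meas_\<nu> maps maps_g\<close>)
    qed
    show ?coiso
      unfolding coiso_iff
    proof (intro conjI ballI allI impI)
      fix f assume f: "f \<in> Lp_fun p \<mu>"
      \<comment> \<open>The product \<open>g f\<close> is one of the functions whose norm \<open>M\<^sub>h\<close> preserves, and \<open>f\<close> is a preimage of it.\<close>
      have "Lp_seminorm q \<nu> (\<lambda>x. g x * f x) = Lp_seminorm p \<mu> (\<lambda>x. h x * (g x * f x))"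
        using norm_eq[OF maps_g[OF f]] by simp
      also have "\<dots> \<le> Lp_seminorm p \<mu> f"
        using meas_\<mu>[OF maps[OF maps_g[OF f]]] f by (rule Lp_dominated(2)) (rule dominated, simp)
      finally show "Lp_seminorm q \<nu> (\<lambda>x. g x * f x) \<le> Lp_seminorm p \<mu> f" .
    next
      fix c :: real and y assume "1 < c" and y: "y \<in> Lp_fun q \<nu>"
      then have "Lp_seminorm p \<mu> (\<lambda>x. h x * y x) \<le> c * Lp_seminorm q \<nu> y"
        using mult_right_mono[of 1 c "Lp_seminorm q \<nu> y"] by (simp add: norm_eq Lp_seminorm_nonneg)
      with inverse[OF y] maps[OF y] show "\<exists>f\<in>Lp_fun p \<mu>.
          (AE x in \<nu>. g x * f x = y x) \<and> Lp_seminorm p \<mu> f \<le> c * Lp_seminorm q \<nu> y"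
        by (intro bexI[of _ "\<lambda>x. h x * y x"] conjI)
    qed
  qed
  then show ?thesis unfolding h_def .
qed

end
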